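(* Let $t \ge 1$ and $k \ge t+1$ be integers. For each $i$ with $0 \le i \le t+1$, put $s_i = 2^{t+1} - 2^{(t+1)-i}$. Then for each such $i$ there exists (for some positive integer $v$) a $t$-$(v,k)$ Latin trade of volume $s_i$.
   Context: Let $t \le k$ and $v$ be positive integers, $V = \{1,\dots,v\}$, and let $V^k$ be the set of ordered $k$-tuples of elements of $V$. For a $t$-subset $I = \{i_1 < \cdots < i_t\}$ of $\{1,\dots,k\}$ and $(u_1,\dots,u_t) \in V^t$, the tuple $(x_1,\dots,x_k) \in V^k$ is said to contain $(u_1,\dots,u_t)_I$ if $x_{i_j} = u_j$ for all $j = 1,\dots,t$. A $t$-$(v,k)$ Latin trade of volume $s$ is a pair $T = (T_1,T_2)$ of disjoint collections (finite multisets, i.e. repeated elements are allowed; disjoint means no tuple occurs in both), each consisting of $s$ elements of $V^k$ counted with multiplicity, such that for each $t$-subset $I \subseteq \{1,\dots,k\}$ and each $(u_1,\dots,u_t) \in V^t$, the number of elements (with multiplicity) of $T_1$ containing $(u_1,\dots,u_t)_I$ equals the number of elements of $T_2$ containing $(u_1,\dots,u_t)_I$. The trade with $T_1 = T_2 = \emptyset$ (volume $0$) is allowed and is called trivial. *)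

theory Defs
  imports Main "HOL-Library.Multiset"
begin

(* A k-tuple is a list of length k. Coordinates are numbered from 0, so a coordinate set I
   is a subset of {..<k}; the alphabet is {1..v}. *)
definition tuples :: "nat \<Rightarrow> nat \<Rightarrow> nat list set" where
  "tuples v k = {x. length x = k \<and> set x \<subseteq> {1..v}}"

definition contains_at :: "nat list \<Rightarrow> nat set \<Rightarrow> nat list \<Rightarrow> bool" where
  "contains_at x I u \<longleftrightarrow> (\<forall>j < card I. x ! (sorted_list_of_set I ! j) = u ! j)"

definition latin_trade ::
  "nat \<Rightarrow> nat \<Rightarrow> nat \<Rightarrow> nat \<Rightarrow> nat list multiset \<times> nat list multiset \<Rightarrow> bool" where
  "latin_trade t v k s T \<longleftrightarrow> (case T of (T1, T2) \<Rightarrow>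
     set_mset T1 \<subseteq> tuples v k \<and> set_mset T2 \<subseteq> tuples v k \<and>
     set_mset T1 \<inter> set_mset T2 = {} \<and>
     size T1 = s \<and> size T2 = s \<and>
     (\<forall>I u. I \<subseteq> {..<k} \<and> card I = t \<and> u \<in> tuples v t \<longrightarrow>
        size (filter_mset (\<lambda>x. contains_at x I u) T1) =
        size (filter_mset (\<lambda>x. contains_at x I u) T2)))"

end

theory Submission
  imports Defs
begin

text \<open>Regard a trade as the formal difference of its two halves. The minimal trade is the
  product of \<open>1 - f j\<close> over the coordinates \<open>j \<le> t\<close>, padded by ones; its term indexed by
  \<open>S \<subseteq> {..t}\<close> carries \<open>f j\<close> at the coordinates \<open>j \<in> S\<close>, with sign \<open>(-1)^|S|\<close>. Subtract from the
  product with \<open>f = 2\<close> everywhere the product with \<open>f j = 3\<close> for \<open>j < i\<close> and \<open>f j = 2\<close> elsewhere.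
  Exactly the \<open>2^(t+1-i)\<close> terms with \<open>S\<close> disjoint from \<open>{..<i}\<close> cancel.\<close>

definition subst_word :: "nat \<Rightarrow> (nat \<Rightarrow> nat) \<Rightarrow> nat set \<Rightarrow> nat list" where
  "subst_word k f S = map (\<lambda>j. if j \<in> S then f j else 1) [0..<k]"

lemma length_subst_word [simp]: "length (subst_word k f S) = k"
  by (simp add: subst_word_def)

lemma nth_subst_word [simp]:
  "j < k \<Longrightarrow> subst_word k f S ! j = (if j \<in> S then f j else 1)"
  by (simp add: subst_word_def)

lemma subst_word_in_tuples:
  assumes "v \<ge> 1" and "\<And>j. f j \<in> {1..v}"
  shows "subst_word k f S \<in> tuples v k"
  using assms by (auto simp: tuples_def subst_word_def)

text \<open>Since \<open>f\<close> avoids 1, \<open>S\<close> can be read off as the set of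
  positions below \<open>k\<close> whose letter is not 1.\<close>

lemma subst_word_inj:
  assumes "subst_word k f S = subst_word k f S'" and "\<And>j. f j \<noteq> 1"
    and "S \<subseteq> {..<k}" and "S' \<subseteq> {..<k}"
  shows "S = S'"
proof (intro set_eqI)
  fix j
  show "j \<in> S \<longleftrightarrow> j \<in> S'"
  proof (cases "j < k")
    case True
    then have "(if j \<in> S then f j else 1) = (if j \<in> S' then f j else 1)"
      using assms(1) by (metis nth_subst_word)
    then show ?thesis using assms(2)[of j] by presburger
  next
    case False
    then show ?thesis using assms(3,4) by blast
  qed
qed

lemma subst_word_cong:
  assumes "\<And>j. j \<in> S \<Longrightarrow> f j = g j"
  shows "subst_word k f S = subst_word k g S"
  using assms by (simp add: subst_word_def)

text \<open>Containment at \<open>I\<close> inspects only coordinates in \<open>I\<close>, so a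
  change of \<open>S\<close> outside \<open>I\<close> goes unnoticed.\<close>

lemma contains_at_subst_word_cong:
  assumes "I \<subseteq> {..<k}" and "S \<inter> I = S' \<inter> I"
  shows "contains_at (subst_word k f S) I u \<longleftrightarrow> contains_at (subst_word k f S') I u"
proof -
  have "finite I" using assms(1) finite_subset by blast
  then have "sorted_list_of_set I ! n \<in> I" if "n < card I" for n
    using that by (metis length_sorted_list_of_set nth_mem set_sorted_list_of_set)
  then have "subst_word k f S ! (sorted_list_of_set I ! n)
    = subst_word k f S' ! (sorted_list_of_set I ! n)" if "n < card I" for n
    using that assms by (metis Int_iff lessThan_iff nth_subst_word subsetD)
  then show ?thesis by (simp add: contains_at_def)
qed

text \<open>Toggling membership of \<open>j\<close> is an involution on the subsets of
  \<open>U\<close> that flips parity. The assumption on \<open>P\<close> says that \<open>P\<close>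
  ignores \<open>j\<close>, so the involution preserves it.\<close>

lemma card_even_subsets_eq_odd:
  assumes "finite U" and "j \<in> U"
    and P: "\<And>S. P (insert j S) \<longleftrightarrow> P (S - {j})"
  shows "card {S. S \<subseteq> U \<and> even (card S) \<and> P S} = card {S. S \<subseteq> U \<and> odd (card S) \<and> P S}"
proof -
  define h where "h = (\<lambda>S. if j \<in> S then S - {j} else insert j S)"
  have hh: "h (h S) = S" for S by (auto simp: h_def)
  have sub: "h S \<subseteq> U" if "S \<subseteq> U" for S using that assms(2) by (auto simp: h_def)
  have par: "even (card (h S)) \<longleftrightarrow> odd (card S)" if "S \<subseteq> U" for S
  proof (cases "j \<in> S")
    case True
    have "finite S" using that assms(1) finite_subset by blast
    then have "Suc (card (S - {j})) = card S" using True by (rule card_Suc_Diff1)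
    then show ?thesis using True by (metis h_def even_Suc)
  next
    case False
    moreover have "finite S" using that assms(1) finite_subset by blast
    ultimately show ?thesis by (simp add: h_def)
  qed
  have Ph: "P (h S) \<longleftrightarrow> P S" for S
    using P[of S] by (auto simp: h_def insert_absorb)
  show ?thesis
    by (rule bij_betw_same_card[of h], rule bij_betw_byWitness[where f' = h])
      (auto simp: hh par Ph dest: subsetD[OF sub])
qed

text \<open>The subsets excluded are exactly those of \<open>U - A\<close>.\<close>

lemma card_subsets_meeting:
  assumes "finite U" and "A \<subseteq> U"
  shows "card {S. S \<subseteq> U \<and> S \<inter> A \<noteq> {}} = 2 ^ card U - 2 ^ (card U - card A)"
proof -
  have eq: "{S. S \<subseteq> U \<and> S \<inter> A \<noteq> {}} = Pow U - Pow (U - A)" by auto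
  have "finite A" using assms finite_subset by blast
  then show ?thesis
    unfolding eq using assms
    by (subst card_Diff_subset) (auto simp: card_Pow card_Diff_subset)
qed

lemma size_filter_image_mset_set:
  assumes "finite A"
  shows "size (filter_mset P (image_mset f (mset_set A))) = card {S \<in> A. P (f S)}"
  using assms by (simp add: filter_mset_image_mset)

theorem theorem1:
  fixes t k i :: nat
  assumes "t \<ge> 1" and "k \<ge> t + 1" and "i \<le> t + 1"
  shows "\<exists>v::nat. v \<ge> 1 \<and>
    (\<exists>T. latin_trade t v k (2 ^ (t + 1) - 2 ^ (t + 1 - i)) T)"
proof -
  define a where "a = subst_word k (\<lambda>_. 2)"
  define b where "b = subst_word k (\<lambda>j. if j < i then 3 else 2)"
  define M where "M = {S. S \<subseteq> {..t} \<and> S \<inter> {..<i} \<noteq> {}}"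
  define E where "E = {S \<in> M. even (card S)}"
  define O' where "O' = {S \<in> M. odd (card S)}"
  \<comment> \<open>\<open>T1\<close> gathers the positive terms of the difference,
    \<open>T2\<close> the negative ones. Subtracting the second product reverses its signs, so
    \<open>b\<close> takes the opposite parity from \<open>a\<close>.\<close>
  define T1 where "T1 = image_mset a (mset_set E) + image_mset b (mset_set O')"
  define T2 where "T2 = image_mset a (mset_set O') + image_mset b (mset_set E)"
  have fin: "finite M" "finite E" "finite O'"
    unfolding M_def E_def O'_def by auto
  have below: "S \<subseteq> {..<k}" if "S \<in> M" for S
    using that assms(2) by (auto simp: M_def)
  have a_tup: "a S \<in> tuples 3 k" and b_tup: "b S \<in> tuples 3 k" for S
    unfolding a_def b_def by (auto intro!: subst_word_in_tuples)
  have a_inj: "S = S'" if "a S = a S'" "S \<in> M" "S' \<in> M" for S S'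
    using subst_word_inj[OF that(1)[unfolded a_def]] that below by auto
  have b_inj: "S = S'" if "b S = b S'" "S \<in> M" "S' \<in> M" for S S'
    using subst_word_inj[OF that(1)[unfolded b_def]] that below by auto
  \<comment> \<open>At a coordinate \<open>j < i\<close> of \<open>S\<close> the letter of
    \<open>a S\<close> is 2, while \<open>b S'\<close> only has 1 or 3 there.\<close>
  have ab: "a S \<noteq> b S'" if SM: "S \<in> M" for S S'
  proof -
    obtain j where j: "j \<in> S" "j < i" using SM by (auto simp: M_def)
    then have "j < k" using below SM by auto
    then have "a S ! j \<noteq> b S' ! j" using j by (simp add: a_def b_def)
    then show ?thesis by auto
  qed
  have "E \<union> O' = M" "E \<inter> O' = {}" by (auto simp: E_def O'_def)
  then have "card E + card O' = card M"
    using fin by (metis card_Un_disjoint)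
  \<comment> \<open>Here \<open>i \<le> t + 1\<close> is what places \<open>{..<i}\<close> inside
    \<open>{..t}\<close>.\<close>
  also have "card M = 2 ^ (t + 1) - 2 ^ (t + 1 - i)"
    unfolding M_def by (subst card_subsets_meeting) (use assms(3) in auto)
  finally have card: "card E + card O' = 2 ^ (t + 1) - 2 ^ (t + 1 - i)" .
  have disj: "set_mset T1 \<inter> set_mset T2 = {}"
  proof -
    have "a ` E \<inter> a ` O' = {}" "b ` E \<inter> b ` O' = {}"
      using a_inj b_inj unfolding E_def O'_def by blast+
    moreover have "a ` E \<inter> b ` E = {}" "a ` O' \<inter> b ` O' = {}"
      using ab unfolding E_def O'_def by blast+
    ultimately show ?thesis
      unfolding T1_def T2_def using fin by auto
  qed
  have bal: "size (filter_mset (\<lambda>x. contains_at x I u) T1) =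
        size (filter_mset (\<lambda>x. contains_at x I u) T2)"
    if I: "I \<subseteq> {..<k}" "card I = t" for I u
  proof -
    define Q where "Q = (\<lambda>x. contains_at x I u)"
    \<comment> \<open>The \<open>t + 1\<close> factors outnumber the \<open>t\<close> coordinates of
      \<open>I\<close>, so some factor \<open>j\<close> lies outside \<open>I\<close> and can serve
      as the toggled element.\<close>
    have "\<not> {..t} \<subseteq> I"
    proof
      assume "{..t} \<subseteq> I"
      then have "card {..t} \<le> card I"
        using I(1) finite_subset by (intro card_mono) auto
      then show False using I(2) by simp
    qed
    then obtain j where j: "j \<in> {..t}" "j \<notin> I" by auto
    have PQ: "Q (subst_word k f (insert j S)) \<longleftrightarrow> Q (subst_word k f (S - {j}))" for f S
      unfolding Q_def using j(2) by (intro contains_at_subst_word_cong[OF I(1)]) auto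
    \<comment> \<open>The cancelled index sets are counted through \<open>a\<close> alone:
      \<open>b\<close> gives the same words there, so both products share \<open>N0\<close> and
      \<open>N1\<close>.\<close>
    define N0 where "N0 = {S. S \<subseteq> {..t} - {..<i} \<and> even (card S) \<and> Q (a S)}"
    define N1 where "N1 = {S. S \<subseteq> {..t} - {..<i} \<and> odd (card S) \<and> Q (a S)}"
    have agree: "b S = a S" if "S \<inter> {..<i} = {}" for S
      unfolding a_def b_def by (rule subst_word_cong) (use that in auto)
    \<comment> \<open>The cancelling terms are added back, as only the full products are balanced.\<close>
    have split: "card {S \<in> E. Q (c S)} + card N0 = card {S \<in> O'. Q (c S)} + card N1"
      if c: "c = subst_word k f" and ca: "\<And>S. S \<inter> {..<i} = {} \<Longrightarrow> c S = a S" for c f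
    proof -
      have cong: "Q (c S) \<longleftrightarrow> Q (a S)" if "S \<subseteq> {..t} - {..<i}" for S
        using ca[of S] that by (fastforce simp: disjoint_iff)
      have finN: "finite N0" "finite N1"
        by (auto simp: N0_def N1_def intro: finite_subset[of _ "Pow {..t}"])
      have "{S. S \<subseteq> {..t} \<and> even (card S) \<and> Q (c S)} = {S \<in> E. Q (c S)} \<union> N0"
        unfolding E_def M_def N0_def using cong by auto
      moreover have "{S \<in> E. Q (c S)} \<inter> N0 = {}" by (auto simp: E_def M_def N0_def)
      moreover have "{S. S \<subseteq> {..t} \<and> odd (card S) \<and> Q (c S)} = {S \<in> O'. Q (c S)} \<union> N1"
        unfolding O'_def M_def N1_def using cong by auto
      moreover have "{S \<in> O'. Q (c S)} \<inter> N1 = {}" by (auto simp: O'_def M_def N1_def)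
      moreover have "card {S. S \<subseteq> {..t} \<and> even (card S) \<and> Q (c S)}
          = card {S. S \<subseteq> {..t} \<and> odd (card S) \<and> Q (c S)}"
        using j(1) PQ unfolding c by (intro card_even_subsets_eq_odd) auto
      ultimately show ?thesis using fin finN by (simp add: card_Un_disjoint)
    qed
    \<comment> \<open>Subtracting the balance equation of \<open>b\<close> from that of
      \<open>a\<close> eliminates \<open>N0\<close> and \<open>N1\<close>.\<close>
    have "card {S \<in> E. Q (a S)} + card {S \<in> O'. Q (b S)}
        = card {S \<in> O'. Q (a S)} + card {S \<in> E. Q (b S)}"
      using split[OF a_def] split[OF b_def agree] by simp
    then have "size (filter_mset Q T1) = size (filter_mset Q T2)"
      using fin by (simp only: T1_def T2_def filter_union_mset size_union
          size_filter_image_mset_set)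
    then show ?thesis by (simp add: Q_def)
  qed
  have "latin_trade t 3 k (2 ^ (t + 1) - 2 ^ (t + 1 - i)) (T1, T2)"
    unfolding latin_trade_def prod.case
  proof (intro conjI allI impI)
    show "set_mset T1 \<subseteq> tuples 3 k" "set_mset T2 \<subseteq> tuples 3 k"
      using fin a_tup b_tup by (auto simp: T1_def T2_def)
    show "size T1 = 2 ^ (t + 1) - 2 ^ (t + 1 - i)" "size T2 = 2 ^ (t + 1) - 2 ^ (t + 1 - i)"
      using card by (simp_all add: T1_def T2_def)
  qed (use disj bal in auto)
  then show ?thesis by (intro exI[of _ 3]) auto
qed

end
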